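(* Let $A,B\in\mathbb{S}^d_>$ and $G,H\in\mathbb{S}^d$, and let $G_t,H_t\in\mathbb{S}^d$ for $t>0$ be such that $G_t\to G$ and $H_t\to H$ element-wise as $t\downarrow0$. The map $\phi:(\mathbb{S}^d_>)^2\to\mathbb{R}$, $\phi(A,B)=2\operatorname{tr}\bigl((A^{1/2}BA^{1/2})^{1/2}\bigr)$, satisfies $$\lim_{t\downarrow0}t^{-1}\bigl(\phi(A+tG_t,B+tH_t)-\phi(A,B)\bigr)=\operatorname{tr}(JG)+\operatorname{tr}(J^{-1}H),$$ i.e. the right-hand side is the Fréchet derivative of $\phi$ at $(A,B)$ evaluated at $(G,H)$, where $$J=A^{-1/2}(A^{1/2}BA^{1/2})^{1/2}A^{-1/2}=B^{1/2}(B^{1/2}AB^{1/2})^{-1/2}B^{1/2},$$ $$J^{-1}=A^{1/2}(A^{1/2}BA^{1/2})^{-1/2}A^{1/2}=B^{-1/2}(B^{1/2}AB^{1/2})^{1/2}B^{-1/2}.$$ As a consequence, the Fréchet derivative of the squared Bures--Wasserstein distance is $$\lim_{t\downarrow0}t^{-1}\bigl(d_W^2(A+tG_t,B+tH_t)-d_W^2(A,B)\bigr)=\operatorname{tr}\bigl((I_d-J)G\bigr)+\operatorname{tr}\bigl((I_d-J^{-1})H\bigr).$$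
   Context: $\mathbb{S}^d$ and $\mathbb{S}^d_>$ are the sets of real symmetric and real symmetric positive definite $d\times d$ matrices. The squared Bures--Wasserstein distance is $d_W^2(A,B)=\operatorname{tr}(A)+\operatorname{tr}(B)-2\operatorname{tr}\bigl((A^{1/2}BA^{1/2})^{1/2}\bigr)$. For $t>0$ sufficiently small, $A+tG_t$ and $B+tH_t$ are positive definite. *)

theory Defs
  imports "HOL-Analysis.Analysis"
begin

definition sym_mats :: "(real^'n^'n) set"
  where "sym_mats = {A. transpose A = A}"

definition psd_mats :: "(real^'n^'n) set"
  where "psd_mats = {A \<in> sym_mats. \<forall>x. 0 \<le> x \<bullet> (A *v x)}"

definition pd_mats :: "(real^'n^'n) set"
  where "pd_mats = {A \<in> sym_mats. \<forall>x. x \<noteq> 0 \<longrightarrow> 0 < x \<bullet> (A *v x)}"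

text \<open>The principal square root: every positive semidefinite matrix has exactly one positive
  semidefinite square root. The value is unspecified outside \<^const>\<open>psd_mats\<close>.\<close>

definition mat_sqrt :: "real^'n^'n \<Rightarrow> real^'n^'n"
  where "mat_sqrt A = (THE S. S \<in> psd_mats \<and> S ** S = A)"

text \<open>The power $A^{-1/2}$, meaningful for positive definite $A$.\<close>

definition mat_inv_sqrt :: "real^'n^'n \<Rightarrow> real^'n^'n"
  where "mat_inv_sqrt A = matrix_inv (mat_sqrt A)"

definition bw_phi :: "real^'n^'n \<Rightarrow> real^'n^'n \<Rightarrow> real"
  where "bw_phi A B = 2 * trace (mat_sqrt (mat_sqrt A ** B ** mat_sqrt A))"

definition bw_dist_sq :: "real^'n^'n \<Rightarrow> real^'n^'n \<Rightarrow> real"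
  where "bw_dist_sq A B =
    trace A + trace B - 2 * trace (mat_sqrt (mat_sqrt A ** B ** mat_sqrt A))"

text \<open>The matrix $J$, i.e. the optimal transport map between the centred Gaussian measures
  with covariance matrices $A$ and $B$.\<close>

definition bw_J :: "real^'n^'n \<Rightarrow> real^'n^'n \<Rightarrow> real^'n^'n"
  where "bw_J A B =
    mat_inv_sqrt A ** mat_sqrt (mat_sqrt A ** B ** mat_sqrt A) ** mat_inv_sqrt A"

end

theory Submission
  imports Defs
begin

text \<open>
  The derivative comes out of a variational formula, so that no matrix square root ever has to
  be differentiated. For positive definite \<open>A\<close>, \<open>B\<close> and every positive definite \<open>S\<close>,
  \<open>\<phi>(A,B) \<le> tr (S A) + tr (S\<^sup>-\<^sup>1 B)\<close>,
  with equality for \<open>S = J(A,B)\<close>. The right-hand side is linear in \<open>(A,B)\<close>, so \<open>\<phi>\<close> is an infimum of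
  linear functions, and \<open>(J(A,B), J(A,B)\<^sup>-\<^sup>1)\<close> is a supergradient of \<open>\<phi>\<close> at \<open>(A,B)\<close> for the trace inner
  product (\<open>bw_phi_le\<close>, \<open>bw_phi_eq\<close>). A function with a supergradient chosen at each
  point of a set is differentiable within the set wherever the choice is continuous, and its gradient
  there is the supergradient (\<open>has_derivative_supergradient\<close>). The directional limits along \<open>t \<mapsto> (A + tG\<^sub>t, B + tH\<^sub>t)\<close>
  follow by the chain rule, and the statements about the distance by subtracting \<open>\<phi>\<close>
  from the linear map \<open>tr A + tr B\<close>.

  The algebra rests on one characterization: \<open>J(A,B)\<close> is the only positive definite solution of
  \<open>X A X = B\<close> (\<open>bw_J_equation\<close>, \<open>bw_J_unique\<close>). Multiplying the equation by inverses gives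
  \<open>J(A,B)\<^sup>-\<^sup>1 = J(B,A)\<close>, which turns the two expressions in terms of \<open>A\<^sup>1\<^sup>/\<^sup>2\<close> into those in terms of \<open>B\<^sup>1\<^sup>/\<^sup>2\<close>. It
  also turns the variational inequality into a completed square,
  \<open>tr (S A) - 2 tr (J A) + tr (S\<^sup>-\<^sup>1 J A J) = tr ((S - J) S\<^sup>-\<^sup>1 (S - J) A) \<ge> 0\<close>.

  Continuity of \<open>J\<close> reduces to continuity of inversion and of the square root. If \<open>S \<ge> c I\<close> with
  \<open>c > 0\<close> and \<open>T\<close> is positive semidefinite, then \<open>c |S - T| \<le> |S\<^sup>2 - T\<^sup>2|\<close> in the Frobenius norm
  (\<open>psd_square_diff_bound\<close>). This gives both the uniqueness and the continuity of the square
  root without eigenvalues. Existence is a fixed point argument: after scaling, \<open>A = I - R\<close>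
  with \<open>R\<close> of operator norm below 1, and \<open>I - Y\<close> is a square root of \<open>A\<close> exactly when
  \<open>Y = (R + Y\<^sup>2)/2\<close>.
\<close>

section \<open>Matrices as a Euclidean space\<close>

lemma transpose_add: "transpose (X + Y) = transpose X + transpose (Y :: real^'n^'m)"
  by (simp add: transpose_def vec_eq_iff)

lemma transpose_diff: "transpose (X - Y) = transpose X - transpose (Y :: real^'n^'m)"
  by (simp add: transpose_def vec_eq_iff)

lemma linear_transpose: "linear (transpose :: real^'n^'m \<Rightarrow> real^'m^'n)"
  by (rule linearI) (simp_all add: transpose_add transpose_scalar)

lemma bounded_bilinear_matrix_mult:
  "bounded_bilinear ((**) :: real^'n^'m \<Rightarrow> real^'k^'n \<Rightarrow> real^'k^'m)"
  unfolding bilinear_conv_bounded_bilinear[symmetric] bilinear_def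
  by (auto intro!: linearI simp: matrix_matrix_mult_def vec_eq_iff sum.distrib
      sum_distrib_left algebra_simps)

lemma bounded_bilinear_matrix_vector_mult:
  "bounded_bilinear ((*v) :: real^'n^'m \<Rightarrow> real^'n \<Rightarrow> real^'m)"
  unfolding bilinear_conv_bounded_bilinear[symmetric] bilinear_def
  by (auto intro!: linearI simp: matrix_vector_mult_def vec_eq_iff sum.distrib
      sum_distrib_left algebra_simps)

lemmas matrix_mult_distribs =
  bounded_bilinear.add_left[OF bounded_bilinear_matrix_mult]
  bounded_bilinear.add_right[OF bounded_bilinear_matrix_mult]
  bounded_bilinear.diff_left[OF bounded_bilinear_matrix_mult]
  bounded_bilinear.diff_right[OF bounded_bilinear_matrix_mult]
  bounded_bilinear.scaleR_left[OF bounded_bilinear_matrix_mult]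
  bounded_bilinear.scaleR_right[OF bounded_bilinear_matrix_mult]

lemma inner_transpose: "transpose X \<bullet> transpose Y = X \<bullet> (Y :: real^'n^'m)"
  unfolding inner_vec_def transpose_def
  by (simp add: inner_vec_def) (rule sum.swap)

lemma norm_transpose: "norm (transpose X) = norm (X :: real^'n^'m)"
  by (simp add: norm_eq_sqrt_inner inner_transpose)

lemma trace_transpose_mult: "trace (transpose X ** Y) = X \<bullet> (Y :: real^'n^'m)"
  unfolding inner_vec_def trace_def transpose_def matrix_matrix_mult_def
  by (simp add: inner_vec_def) (rule sum.swap)

lemma trace_sym_mult: "S \<in> sym_mats \<Longrightarrow> trace (S ** X) = S \<bullet> X"
  using trace_transpose_mult[of S X] by (simp add: sym_mats_def)

lemma norm_matrix_vector_mult_le: "norm (X *v x) \<le> norm (X :: real^'n^'m) * norm x"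
proof -
  have "norm (X *v x) = L2_set (\<lambda>i. norm (X $ i \<bullet> x)) UNIV"
    by (simp add: norm_vec_def matrix_vector_mul_component)
  also have "\<dots> \<le> L2_set (\<lambda>i. norm (X $ i) * norm x) UNIV"
    by (intro L2_set_mono) (auto simp: Cauchy_Schwarz_ineq2)
  also have "\<dots> = norm X * norm x"
    by (simp add: norm_vec_def[of X] L2_set_left_distrib)
  finally show ?thesis .
qed

lemma matrix_mult_row: "(X ** S) $ i = transpose S *v (X $ i :: real^'n)"
  by (simp add: matrix_matrix_mult_def matrix_vector_mult_def transpose_def vec_eq_iff mult.commute)

text \<open>
  The inner product and norm of the type of matrices are those of Frobenius. Right multiplication
  by a symmetric \<open>S\<close> acts as \<open>S\<close> on each row, so bounds on \<open>S\<close> as an operator or as a quadratic form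
  pass to the Frobenius norm and inner product row by row. Transposition gives the same
  for left multiplication.
\<close>

lemma norm_mult_right_le:
  fixes X :: "real^'n^'m" and S :: "real^'n^'n"
  assumes "S \<in> sym_mats" "0 \<le> k" "\<And>x. norm (S *v x) \<le> k * norm x"
  shows "norm (X ** S) \<le> k * norm X"
proof -
  have "norm (X ** S) = L2_set (\<lambda>i. norm (S *v X $ i)) UNIV"
    using assms(1) by (simp add: norm_vec_def[of "X ** S"] matrix_mult_row sym_mats_def
        del: transpose_matrix_vector)
  also have "\<dots> \<le> L2_set (\<lambda>i. k * norm (X $ i)) UNIV"
    by (intro L2_set_mono) (auto simp: assms)
  also have "\<dots> = k * norm X"
    using assms(2) by (simp add: norm_vec_def[of X] L2_set_right_distrib)
  finally show ?thesis .
qed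

lemma norm_mult_left_le:
  fixes X :: "real^'m^'n" and S :: "real^'n^'n"
  assumes "S \<in> sym_mats" "0 \<le> k" "\<And>x. norm (S *v x) \<le> k * norm x"
  shows "norm (S ** X) \<le> k * norm X"
proof -
  have eq: "transpose (S ** X) = transpose X ** S"
    using assms(1) by (simp add: matrix_transpose_mul sym_mats_def)
  from norm_mult_right_le[OF assms, of "transpose X"] show ?thesis
    by (simp only: eq[symmetric] norm_transpose)
qed

lemma inner_mult_right_ge:
  fixes X :: "real^'n^'m" and S :: "real^'n^'n"
  assumes "S \<in> sym_mats" "\<And>x. c * (norm x)\<^sup>2 \<le> x \<bullet> (S *v x)"
  shows "c * (norm X)\<^sup>2 \<le> X \<bullet> (X ** S)"
proof -
  have "c * (norm X)\<^sup>2 = (\<Sum>i\<in>UNIV. c * (norm (X $ i))\<^sup>2)"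
    by (simp add: power2_norm_eq_inner inner_vec_def[of X] sum_distrib_left)
  also have "\<dots> \<le> (\<Sum>i\<in>UNIV. X $ i \<bullet> (S *v X $ i))"
    by (intro sum_mono assms)
  also have "\<dots> = X \<bullet> (X ** S)"
    using assms(1) by (simp add: inner_vec_def[of X] matrix_mult_row sym_mats_def
        del: transpose_matrix_vector)
  finally show ?thesis .
qed

lemma inner_mult_left_ge:
  fixes X :: "real^'m^'n" and S :: "real^'n^'n"
  assumes "S \<in> sym_mats" "\<And>x. c * (norm x)\<^sup>2 \<le> x \<bullet> (S *v x)"
  shows "c * (norm X)\<^sup>2 \<le> X \<bullet> (S ** X)"
proof -
  have eq: "transpose (S ** X) = transpose X ** S"
    using assms(1) by (simp add: matrix_transpose_mul sym_mats_def)
  from inner_mult_right_ge[OF assms, of "transpose X"] show ?thesis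
    by (simp only: eq[symmetric] inner_transpose norm_transpose)
qed

section \<open>Matrix inverses\<close>

lemma matrix_inv_eqI:
  fixes X Y :: "real^'n^'n"
  assumes "X ** Y = mat 1"
  shows "matrix_inv X = Y"
proof -
  have YX: "Y ** X = mat 1" using assms matrix_left_right_inverse by blast
  have "X ** matrix_inv X = mat 1 \<and> matrix_inv X ** X = mat 1"
    unfolding matrix_inv_def by (rule someI[of _ Y]) (simp add: assms YX)
  then have "matrix_inv X = Y ** X ** matrix_inv X" by (simp add: YX)
  also have "\<dots> = Y"
    using \<open>X ** matrix_inv X = mat 1 \<and> matrix_inv X ** X = mat 1\<close>
    by (simp add: matrix_mul_assoc[symmetric])
  finally show ?thesis .
qed

lemma
  fixes X :: "real^'n^'n"
  assumes "invertible X"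
  shows matrix_inv_right: "X ** matrix_inv X = mat 1"
    and matrix_inv_left: "matrix_inv X ** X = mat 1"
  using assms matrix_inv_eqI unfolding invertible_def by metis+

lemma matrix_cancel: "X ** Y = mat 1 \<Longrightarrow> X ** (Y ** Z) = (Z :: real^'n^'n)"
  by (simp add: matrix_mul_assoc)

lemma continuous_on_det: "continuous_on S (det :: real^'n^'n \<Rightarrow> real)"
  unfolding det_def by (intro continuous_intros)

text \<open>
  By Cramer's rule each entry of the inverse is a quotient of two determinants, which are
  polynomials in the entries.
\<close>

lemma continuous_on_matrix_inv:
  "continuous_on {X. invertible X} (matrix_inv :: real^'n^'n \<Rightarrow> real^'n^'n)"
proof -
  have entry: "continuous_on {X :: real^'n^'n. invertible X} (\<lambda>X. matrix_inv X $ i $ j)" for i j :: 'n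
  proof (rule continuous_on_eq)
    show "continuous_on {X. invertible X}
       (\<lambda>X. det (\<chi> k l. if l = i then axis j (1::real) $ k else X $ k $ l) / det X)"
    proof (intro continuous_on_divide continuous_on_det)
      have "continuous_on {X. invertible X}
        (\<lambda>X. \<chi> k l. if l = i then axis j (1::real) $ k else X $ k $ l)"
      proof (intro continuous_on_vec_lambda)
        show "continuous_on {X. invertible X}
          (\<lambda>X. if l = i then axis j (1::real) $ k else X $ k $ l)" for k l
          by (cases "l = i") (auto intro!: continuous_intros)
      qed
      then show "continuous_on {X. invertible X}
        (\<lambda>X. det (\<chi> k l. if l = i then axis j (1::real) $ k else X $ k $ l))"
        by (rule continuous_on_compose2[OF continuous_on_det[of UNIV]]) simp
    qed (auto simp: invertible_det_nz)
  next
    fix X :: "real^'n^'n" assume "X \<in> {X. invertible X}"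
    then have X: "invertible X" by simp
    have "X *v (matrix_inv X *v axis j 1) = axis j 1"
      by (simp add: matrix_vector_mul_assoc matrix_inv_right[OF X])
    then have "matrix_inv X *v axis j 1
        = (\<chi> i. det (\<chi> k l. if l = i then axis j 1 $ k else X $ k $ l) / det X)"
      using cramer[of X] X[unfolded invertible_det_nz] by blast
    moreover have "(matrix_inv X *v axis j 1) $ i = matrix_inv X $ i $ j"
      by (simp add: matrix_vector_mul_component inner_axis)
    ultimately show "det (\<chi> k l. if l = i then axis j 1 $ k else X $ k $ l) / det X
        = matrix_inv X $ i $ j"
      by (simp only: vec_lambda_beta)
  qed
  have "continuous_on {X :: real^'n^'n. invertible X} (\<lambda>X. \<chi> i j. matrix_inv X $ i $ j)"
    by (intro continuous_on_vec_lambda entry)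
  then show ?thesis by simp
qed

section \<open>Positive definite matrices\<close>

lemma pd_sym: "S \<in> pd_mats \<Longrightarrow> S \<in> sym_mats"
  and pd_transpose: "S \<in> pd_mats \<Longrightarrow> transpose S = S"
  and pd_pos: "S \<in> pd_mats \<Longrightarrow> x \<noteq> 0 \<Longrightarrow> 0 < x \<bullet> (S *v x)"
  by (auto simp: pd_mats_def sym_mats_def)

lemma pd_psd:
  assumes "S \<in> pd_mats"
  shows "S \<in> psd_mats"
proof -
  have "0 \<le> x \<bullet> (S *v x)" for x
    using pd_pos[OF assms, of x] by (cases "x = 0") simp_all
  then show ?thesis using pd_sym[OF assms] by (simp add: psd_mats_def)
qed

lemma sym_inner_swap:
  assumes "S \<in> sym_mats"
  shows "(S *v x) \<bullet> y = x \<bullet> (S *v y)"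
proof -
  have "S *v x = x v* S"
    using transpose_matrix_vector[of S x] assms unfolding sym_mats_def
    by (simp del: transpose_matrix_vector)
  then show ?thesis by (simp add: dot_lmul_matrix)
qed

text \<open>
  The least value of the quadratic form on the unit sphere is attained, hence positive.
\<close>

lemma pd_coercive:
  assumes "S \<in> pd_mats"
  obtains c where "c > 0" "\<And>x. c * (norm x)\<^sup>2 \<le> x \<bullet> (S *v x)"
proof -
  have "continuous_on (sphere 0 1) (\<lambda>x. x \<bullet> (S *v x))"
    by (intro continuous_intros linear_continuous_on matrix_vector_mul_bounded_linear)
  moreover have "sphere (0 :: real^'a) 1 \<noteq> {}" by simp
  ultimately obtain u where u: "u \<in> sphere 0 1"
    and min: "\<And>x. x \<in> sphere 0 1 \<Longrightarrow> u \<bullet> (S *v u) \<le> x \<bullet> (S *v x)"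
    using continuous_attains_inf[OF compact_sphere] by blast
  let ?c = "u \<bullet> (S *v u)"
  have "?c > 0" using pd_pos[OF assms, of u] u by (cases "u = 0") simp_all
  moreover have "?c * (norm x)\<^sup>2 \<le> x \<bullet> (S *v x)" for x
  proof (cases "x = 0")
    case False
    have "?c \<le> (x /\<^sub>R norm x) \<bullet> (S *v (x /\<^sub>R norm x))"
      using False by (intro min) simp
    also have "\<dots> = (x \<bullet> (S *v x)) / (norm x)\<^sup>2"
      by (simp add: matrix_vector_mult_scaleR power2_eq_square divide_inverse)
    finally show ?thesis using False by (simp add: pos_le_divide_eq)
  qed simp
  ultimately show ?thesis using that by blast
qed

lemma pd_near:
  assumes "S \<in> pd_mats"
  obtains e where "e > 0" "\<And>T. T \<in> sym_mats \<Longrightarrow> norm (T - S) < e \<Longrightarrow> T \<in> pd_mats"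
proof -
  obtain c where c: "c > 0" "\<And>x. c * (norm x)\<^sup>2 \<le> x \<bullet> (S *v x)"
    by (rule pd_coercive[OF assms]) blast
  have "T \<in> pd_mats" if T: "T \<in> sym_mats" "norm (T - S) < c" for T
  proof -
    have "0 < x \<bullet> (T *v x)" if "x \<noteq> 0" for x
    proof -
      have "\<bar>x \<bullet> ((T - S) *v x)\<bar> \<le> norm x * (norm (T - S) * norm x)"
        by (intro order.trans[OF Cauchy_Schwarz_ineq2] mult_left_mono norm_matrix_vector_mult_le) simp
      also have "\<dots> < norm x * (c * norm x)"
        using T(2) \<open>x \<noteq> 0\<close> by simp
      finally have "\<bar>x \<bullet> ((T - S) *v x)\<bar> < c * (norm x)\<^sup>2"
        by (simp add: power2_eq_square algebra_simps)
      moreover have "x \<bullet> (T *v x) = x \<bullet> (S *v x) + x \<bullet> ((T - S) *v x)"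
        by (simp add: matrix_vector_mult_diff_rdistrib inner_diff_right)
      ultimately show ?thesis using c(2)[of x] by linarith
    qed
    with T show ?thesis by (simp add: pd_mats_def)
  qed
  with c(1) that show ?thesis by blast
qed

lemma pd_invertible:
  assumes "S \<in> pd_mats"
  shows "invertible S"
proof -
  have "x = 0" if "S *v x = 0" for x
    using pd_pos[OF assms, of x] that by auto
  then show ?thesis
    by (simp add: invertible_left_inverse matrix_left_invertible_ker)
qed

lemmas pd_inv_right = matrix_inv_right[OF pd_invertible]
  and pd_inv_left = matrix_inv_left[OF pd_invertible]

lemma pd_congruence:
  assumes "P \<in> sym_mats" "invertible P" "X \<in> pd_mats"
  shows "P ** X ** P \<in> pd_mats"
proof -
  have "0 < x \<bullet> ((P ** X ** P) *v x)" if "x \<noteq> 0" for x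
  proof -
    have "P *v x \<noteq> 0"
      using assms(2) that by (metis invertible_left_inverse matrix_left_invertible_ker)
    moreover have "x \<bullet> ((P ** X ** P) *v x) = (P *v x) \<bullet> (X *v (P *v x))"
      by (simp add: matrix_vector_mul_assoc sym_inner_swap[OF assms(1)] matrix_mul_assoc)
    ultimately show ?thesis using pd_pos[OF assms(3)] by simp
  qed
  moreover have "transpose (P ** X ** P) = P ** X ** P"
    using assms(1) pd_transpose[OF assms(3)]
    by (simp add: sym_mats_def matrix_transpose_mul matrix_mul_assoc)
  ultimately show ?thesis by (simp add: pd_mats_def sym_mats_def)
qed

lemma pd_matrix_inv:
  assumes "S \<in> pd_mats"
  shows "matrix_inv S \<in> pd_mats"
proof -
  have "transpose (matrix_inv S) ** S = mat 1"
    by (metis assms matrix_transpose_mul pd_inv_right pd_transpose transpose_mat)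
  then have sym: "transpose (matrix_inv S) = matrix_inv S"
    by (metis matrix_inv_eqI matrix_left_right_inverse)
  have inv: "invertible (matrix_inv S)"
    using invertible_def pd_inv_left[OF assms] pd_inv_right[OF assms] by blast
  have "matrix_inv S ** S ** matrix_inv S \<in> pd_mats"
    by (intro pd_congruence inv assms) (simp add: sym_mats_def sym)
  then show ?thesis by (simp add: pd_inv_left[OF assms])
qed

section \<open>The square root of a positive definite matrix\<close>

text \<open>
  The map \<open>Y \<mapsto> (R + Y\<^sup>2)/2\<close> preserves the symmetric matrices of operator norm at most \<open>k\<close>
  when \<open>r + k\<^sup>2 \<le> 2k\<close>, and it contracts them with factor \<open>k\<close> because
  \<open>Y\<^sup>2 - Z\<^sup>2 = Y(Y - Z) + (Y - Z)Z\<close>. The smaller root of \<open>r + k\<^sup>2 = 2k\<close> lies below 1.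
\<close>

lemma sqrt_fixpoint:
  fixes R :: "real^'n^'n"
  assumes R: "R \<in> sym_mats" and r: "0 \<le> r" "r < 1"
    and bound: "\<And>x. norm (R *v x) \<le> r * norm x"
  obtains Y k where "Y \<in> sym_mats" "0 \<le> k" "k < 1"
    "\<And>x. norm (Y *v x) \<le> k * norm x" "2 *\<^sub>R Y = R + Y ** Y"
proof -
  define k where "k = 1 - sqrt (1 - r)"
  have k: "0 \<le> k" "k < 1" and kr: "r + k * k = 2 * k"
    using r by (auto simp: k_def algebra_simps)
  define F where "F Y = (1/2) *\<^sub>R (R + Y ** Y)" for Y
  define K where "K = {Y :: real^'n^'n. Y \<in> sym_mats \<and> (\<forall>x. norm (Y *v x) \<le> k * norm x)}"
  have trans_cont: "continuous_on UNIV (transpose :: real^'n^'n \<Rightarrow> _)"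
    by (intro linear_continuous_on linear_linear[THEN iffD2] linear_transpose)
  have apply_cont: "continuous_on UNIV (\<lambda>Y :: real^'n^'n. Y *v x)" for x
    by (intro linear_continuous_on
        bounded_bilinear.bounded_linear_left[OF bounded_bilinear_matrix_vector_mult])
  have "closed K"
    unfolding K_def sym_mats_def mem_Collect_eq
    by (intro closed_Collect_conj closed_Collect_all closed_Collect_eq closed_Collect_le
        continuous_intros trans_cont apply_cont)
  then have "complete K" by (simp add: complete_eq_closed)
  moreover have "0 \<in> K" by (simp add: K_def sym_mats_def k transpose_def vec_eq_iff)
  moreover have "F ` K \<subseteq> K"
  proof
    fix Z assume "Z \<in> F ` K"
    then obtain Y where Y: "Y \<in> K" and Z: "Z = F Y" by blast
    have "norm (Z *v x) \<le> k * norm x" for x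
    proof -
      have "norm (Z *v x) = (1/2) * norm (R *v x + Y *v (Y *v x))"
        by (simp add: Z F_def matrix_vector_mult_add_rdistrib matrix_vector_mul_assoc
            flip: scaleR_matrix_vector_assoc)
      also have "\<dots> \<le> (1/2) * (r * norm x + k * (k * norm x))"
      proof -
        have "norm (Y *v (Y *v x)) \<le> k * norm (Y *v x)" using Y by (simp add: K_def)
        also have "\<dots> \<le> k * (k * norm x)" using Y k by (intro mult_left_mono) (auto simp: K_def)
        finally show ?thesis using bound[of x] norm_triangle_ineq[of "R *v x" "Y *v (Y *v x)"]
          by simp
      qed
      also have "\<dots> = (1/2) * ((r + k * k) * norm x)" by (simp add: algebra_simps)
      also have "\<dots> = k * norm x" by (simp add: kr)
      finally show ?thesis .
    qed
    moreover have "transpose Z = Z"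
      using Y R by (simp add: Z F_def K_def sym_mats_def transpose_scalar transpose_add
          matrix_transpose_mul)
    ultimately show "Z \<in> K" by (simp add: K_def sym_mats_def)
  qed
  moreover have "dist (F Y) (F Z) \<le> k * dist Y Z" if "Y \<in> K" "Z \<in> K" for Y Z
  proof -
    have "F Y - F Z = (1/2) *\<^sub>R (Y ** (Y - Z) + (Y - Z) ** Z)"
      by (simp add: F_def matrix_mult_distribs algebra_simps)
    then have "dist (F Y) (F Z) = (1/2) * norm (Y ** (Y - Z) + (Y - Z) ** Z)"
      by (simp add: dist_norm)
    also have "\<dots> \<le> (1/2) * (k * norm (Y - Z) + k * norm (Y - Z))"
      using that k norm_mult_left_le[of Y k "Y - Z"] norm_mult_right_le[of Z k "Y - Z"]
        norm_triangle_ineq[of "Y ** (Y - Z)" "(Y - Z) ** Z"]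
      by (simp add: K_def)
    finally show ?thesis by (simp add: dist_norm)
  qed
  ultimately obtain Y where "Y \<in> K" and fixpoint: "F Y = Y"
    using Banach_fix[of K k F] k by blast
  moreover have "2 *\<^sub>R Y = R + Y ** Y"
    by (subst fixpoint[symmetric]) (simp add: F_def)
  ultimately show ?thesis using that[of Y k] k by (simp add: K_def)
qed

text \<open>
  For large \<open>s\<close> the matrix \<open>R = I - A/s\<close> has operator norm below 1: in the expansion
  \<open>|Rx|\<^sup>2 = |x|\<^sup>2 - (2/s) x\<bullet>Ax + |Ax|\<^sup>2/s\<^sup>2\<close> the last term absorbs at most half of the middle one
  once \<open>|A|\<^sup>2 \<le> s c\<close>, where \<open>c\<close> bounds the quadratic form of \<open>A\<close> from below. The fixed point \<open>Y\<close>
  for \<open>R\<close> satisfies \<open>(I - Y)\<^sup>2 = A/s\<close>, and \<open>I - Y\<close> is positive definite because \<open>Y\<close> has norm below 1.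
\<close>

lemma pd_sqrt_exists:
  fixes A :: "real^'n^'n"
  assumes "A \<in> pd_mats"
  obtains S where "S \<in> pd_mats" "S ** S = A"
proof -
  obtain c where c: "c > 0" "\<And>x. c * (norm x)\<^sup>2 \<le> x \<bullet> (A *v x)"
    by (rule pd_coercive[OF assms]) blast
  \<comment> \<open>The second argument of the maximum makes \<open>1 - c/s\<close> nonnegative, so that its root can be taken.\<close>
  define s where "s = max ((norm A)\<^sup>2 / c) c"
  have s: "s > 0" "(norm A)\<^sup>2 \<le> s * c" "c \<le> s"
    using c(1) by (auto simp: s_def max_def field_simps)
  define R where "R = mat 1 - (1/s) *\<^sub>R A"
  define r where "r = sqrt (1 - c/s)"
  have R_sym: "R \<in> sym_mats"
    using pd_transpose[OF assms] by (simp add: R_def sym_mats_def transpose_diff transpose_scalar)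
  have r: "0 \<le> r" "r < 1" "r\<^sup>2 = 1 - c/s"
    using c s by (auto simp: r_def)
  have Rx: "R *v x = x - (1/s) *\<^sub>R (A *v x)" for x
    by (simp add: R_def matrix_vector_mult_diff_rdistrib flip: scaleR_matrix_vector_assoc)
  have "norm (R *v x) \<le> r * norm x" for x
  proof (rule power2_le_imp_le)
    have "(norm (A *v x))\<^sup>2 \<le> (norm A * norm x)\<^sup>2"
      by (intro power_mono norm_matrix_vector_mult_le) simp
    also have "\<dots> \<le> s * c * (norm x)\<^sup>2"
      by (simp add: power_mult_distrib mult_right_mono s)
    finally have Ax: "(norm (A *v x))\<^sup>2 / s\<^sup>2 \<le> c / s * (norm x)\<^sup>2"
      using s(1) by (simp add: field_simps power2_eq_square)
    have "(norm (R *v x))\<^sup>2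
        = (norm x)\<^sup>2 - 2 / s * (x \<bullet> (A *v x)) + (norm (A *v x))\<^sup>2 / s\<^sup>2"
      unfolding Rx power2_norm_eq_inner
      by (simp add: inner_diff inner_commute power2_eq_square)
    also have "\<dots> \<le> (norm x)\<^sup>2 - 2 / s * (c * (norm x)\<^sup>2) + c / s * (norm x)\<^sup>2"
      using Ax c(2)[of x] s(1) by (intro add_mono diff_left_mono mult_left_mono) auto
    also have "\<dots> = (r * norm x)\<^sup>2"
      by (simp add: power_mult_distrib r algebra_simps)
    finally show "(norm (R *v x))\<^sup>2 \<le> (r * norm x)\<^sup>2" .
  qed (use r in simp)
  then obtain Y k where Y: "Y \<in> sym_mats" "0 \<le> k" "k < 1"
    "\<And>x. norm (Y *v x) \<le> k * norm x" "2 *\<^sub>R Y = R + Y ** Y"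
    using sqrt_fixpoint[OF R_sym r(1,2)] by metis
  define S where "S = sqrt s *\<^sub>R (mat 1 - Y)"
  have "S ** S = (sqrt s * sqrt s) *\<^sub>R ((mat 1 - Y) ** (mat 1 - Y))"
    by (simp only: S_def bounded_bilinear.scaleR_left[OF bounded_bilinear_matrix_mult]
        bounded_bilinear.scaleR_right[OF bounded_bilinear_matrix_mult] scaleR_scaleR)
  also have "sqrt s * sqrt s = s" using s(1) by simp
  also have "(mat 1 - Y) ** (mat 1 - Y) = mat 1 - 2 *\<^sub>R Y + Y ** Y"
    by (simp add: matrix_mult_distribs scaleR_2)
  also have "\<dots> = (1/s) *\<^sub>R A"
    by (simp add: Y(5) R_def)
  finally have "S ** S = A" using s(1) by simp
  moreover have "0 < x \<bullet> (S *v x)" if "x \<noteq> 0" for x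
  proof -
    have "x \<bullet> (Y *v x) \<le> norm x * (k * norm x)"
      using Y(4)[of x] norm_cauchy_schwarz[of x "Y *v x"] mult_left_mono[of _ _ "norm x"]
      by (meson norm_ge_zero order_trans)
    also have "\<dots> < norm x * (1 * norm x)"
      using Y(3) that by simp
    finally have "x \<bullet> (Y *v x) < x \<bullet> x"
      by (simp add: power2_norm_eq_inner flip: power2_eq_square)
    then show ?thesis
      using s(1) by (simp add: S_def matrix_vector_mult_diff_rdistrib inner_diff_right
          flip: scaleR_matrix_vector_assoc)
  qed
  moreover have "S \<in> sym_mats"
    using Y(1) by (simp add: S_def sym_mats_def transpose_diff transpose_scalar)
  ultimately have "S \<in> pd_mats" "S ** S = A" by (simp_all add: pd_mats_def)
  then show ?thesis by (rule that)
qed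

text \<open>
  With \<open>D = S - T\<close> one has \<open>S\<^sup>2 - T\<^sup>2 = S D + D T\<close>. In the inner product with \<open>D\<close> the first summand
  contributes at least \<open>c |D|\<^sup>2\<close> and the second a nonnegative number; Cauchy--Schwarz finishes.
\<close>

lemma psd_square_diff_bound:
  fixes S T :: "real^'n^'n"
  assumes S: "S \<in> sym_mats" "\<And>x. c * (norm x)\<^sup>2 \<le> x \<bullet> (S *v x)" and T: "T \<in> psd_mats"
  shows "c * norm (S - T) \<le> norm (S ** S - T ** T)"
proof (cases "S = T")
  case False
  let ?D = "S - T"
  have "c * (norm ?D)\<^sup>2 \<le> ?D \<bullet> (S ** ?D)"
    by (rule inner_mult_left_ge[OF S])
  moreover have "0 \<le> ?D \<bullet> (?D ** T)"
    using T inner_mult_right_ge[of T 0 ?D] by (simp add: psd_mats_def)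
  ultimately have "c * (norm ?D)\<^sup>2 \<le> ?D \<bullet> (S ** ?D + ?D ** T)"
    by (simp add: inner_add_right)
  also have "S ** ?D + ?D ** T = S ** S - T ** T"
    by (simp add: matrix_mult_distribs)
  also have "?D \<bullet> (S ** S - T ** T) \<le> norm ?D * norm (S ** S - T ** T)"
    by (rule norm_cauchy_schwarz)
  finally have "norm ?D * (c * norm ?D) \<le> norm ?D * norm (S ** S - T ** T)"
    by (simp add: power2_eq_square algebra_simps)
  then show ?thesis using False by simp
qed simp

lemma mat_sqrt_eqI:
  assumes "S \<in> pd_mats" "S ** S = A"
  shows "mat_sqrt A = S"
  unfolding mat_sqrt_def
proof (rule the_equality)
  fix T assume T: "T \<in> psd_mats \<and> T ** T = A"
  obtain c where c: "c > 0" "\<And>x. c * (norm x)\<^sup>2 \<le> x \<bullet> (S *v x)"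
    by (rule pd_coercive[OF assms(1)]) blast
  have "c * norm (S - T) \<le> 0"
    using psd_square_diff_bound[OF pd_sym[OF assms(1)] c(2), of T] T assms(2) by simp
  with c(1) show "T = S" by (simp add: mult_le_0_iff)
qed (use assms pd_psd in auto)

lemma
  assumes "A \<in> pd_mats"
  shows mat_sqrt_pd: "mat_sqrt A \<in> pd_mats"
    and mat_sqrt_square: "mat_sqrt A ** mat_sqrt A = A"
  using pd_sqrt_exists[OF assms] mat_sqrt_eqI by metis+

lemma continuous_on_mat_sqrt: "continuous_on pd_mats mat_sqrt"
  unfolding continuous_on_iff
proof (intro ballI allI impI)
  fix A :: "real^'n^'n" and e :: real assume A: "A \<in> pd_mats" and e: "0 < e"
  obtain c where c: "c > 0" "\<And>x. c * (norm x)\<^sup>2 \<le> x \<bullet> (mat_sqrt A *v x)"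
    by (rule pd_coercive[OF mat_sqrt_pd[OF A]]) blast
  have "dist (mat_sqrt B) (mat_sqrt A) < e" if B: "B \<in> pd_mats" "dist B A < c * e" for B
  proof -
    have "c * norm (mat_sqrt A - mat_sqrt B) \<le> norm (A - B)"
      using psd_square_diff_bound[OF pd_sym[OF mat_sqrt_pd[OF A]] c(2)
          pd_psd[OF mat_sqrt_pd[OF B(1)]]]
      by (simp add: mat_sqrt_square A B)
    also have "\<dots> < c * e" using B(2) by (simp add: dist_norm norm_minus_commute)
    finally show ?thesis using c(1) by (simp add: dist_norm norm_minus_commute)
  qed
  with c(1) e show "\<exists>d>0. \<forall>B\<in>pd_mats. dist B A < d \<longrightarrow> dist (mat_sqrt B) (mat_sqrt A) < e"
    by (intro exI[of _ "c * e"]) simp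
qed

section \<open>The optimal transport matrix\<close>

lemma pd_sqrt_congruence:
  "A \<in> pd_mats \<Longrightarrow> B \<in> pd_mats \<Longrightarrow> mat_sqrt A ** B ** mat_sqrt A \<in> pd_mats"
  by (intro pd_congruence pd_sym pd_invertible mat_sqrt_pd)

text \<open>
  Let \<open>P = A\<^sup>1\<^sup>/\<^sup>2\<close> and \<open>M = (PBP)\<^sup>1\<^sup>/\<^sup>2\<close>, so that \<open>J = P\<^sup>-\<^sup>1 M P\<^sup>-\<^sup>1\<close>. Uniqueness holds because
  \<open>X A X = B\<close> makes \<open>P X P\<close> a positive definite square root of \<open>P B P\<close>, hence equal to \<open>M\<close>.
\<close>

lemma
  assumes A: "A \<in> pd_mats" and B: "B \<in> pd_mats"
  shows bw_J_pd: "bw_J A B \<in> pd_mats"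
    and bw_J_equation: "bw_J A B ** A ** bw_J A B = B"
    and matrix_inv_bw_J: "matrix_inv (bw_J A B) =
      mat_sqrt A ** mat_inv_sqrt (mat_sqrt A ** B ** mat_sqrt A) ** mat_sqrt A"
    and bw_phi_eq_trace: "bw_phi A B = 2 * trace (bw_J A B ** A)"
    and bw_J_unique: "\<And>X. X \<in> pd_mats \<Longrightarrow> X ** A ** X = B \<Longrightarrow> X = bw_J A B"
proof -
  define P where "P = mat_sqrt A"
  define M where "M = mat_sqrt (P ** B ** P)"
  have P: "P \<in> pd_mats" "P ** P = A"
    using mat_sqrt_pd[OF A] mat_sqrt_square[OF A] by (simp_all add: P_def)
  have PBP: "P ** B ** P \<in> pd_mats"
    unfolding P_def by (rule pd_sqrt_congruence[OF A B])
  have M: "M \<in> pd_mats" "M ** M = P ** B ** P"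
    using mat_sqrt_pd[OF PBP] mat_sqrt_square[OF PBP] by (simp_all add: M_def)
  have J: "bw_J A B = matrix_inv P ** M ** matrix_inv P"
    by (simp add: bw_J_def mat_inv_sqrt_def P_def M_def)
  note cancel = pd_inv_left[OF P(1)] pd_inv_right[OF P(1)] pd_inv_left[OF M(1)]
    pd_inv_right[OF M(1)] pd_inv_left[OF P(1), THEN matrix_cancel]
    pd_inv_right[OF P(1), THEN matrix_cancel] pd_inv_left[OF M(1), THEN matrix_cancel]
    pd_inv_right[OF M(1), THEN matrix_cancel]
  show "bw_J A B \<in> pd_mats"
    unfolding J by (intro pd_congruence pd_sym pd_invertible pd_matrix_inv P M)
  have "bw_J A B ** (P ** P) ** bw_J A B = matrix_inv P ** (M ** M) ** matrix_inv P"
    unfolding J by (simp add: matrix_mul_assoc[symmetric] cancel)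
  also have "\<dots> = B"
    unfolding M by (simp add: matrix_mul_assoc[symmetric] cancel)
  finally show "bw_J A B ** A ** bw_J A B = B" by (simp add: P)
  have "bw_J A B ** (P ** matrix_inv M ** P) = mat 1"
    unfolding J by (simp add: matrix_mul_assoc[symmetric] cancel)
  then show "matrix_inv (bw_J A B) =
      mat_sqrt A ** mat_inv_sqrt (mat_sqrt A ** B ** mat_sqrt A) ** mat_sqrt A"
    by (intro matrix_inv_eqI) (simp add: mat_inv_sqrt_def P_def M_def)
  have "M = P ** (bw_J A B ** P)"
    unfolding J by (simp add: matrix_mul_assoc[symmetric] cancel)
  then have "trace M = trace (bw_J A B ** P ** P)"
    using trace_mul_sym by metis
  then show "bw_phi A B = 2 * trace (bw_J A B ** A)"
    by (simp add: bw_phi_def P_def M_def matrix_mul_assoc[symmetric] mat_sqrt_square[OF A])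
  fix X assume X: "X \<in> pd_mats" "X ** A ** X = B"
  have "P ** X ** P \<in> pd_mats"
    by (intro pd_congruence pd_sym pd_invertible P X)
  moreover have "(P ** X ** P) ** (P ** X ** P) = P ** (X ** (P ** P) ** X) ** P"
    by (simp add: matrix_mul_assoc)
  ultimately have "M = P ** X ** P"
    unfolding M_def by (intro mat_sqrt_eqI) (simp_all add: P X)
  then show "X = bw_J A B"
    unfolding J by (simp add: matrix_mul_assoc[symmetric] cancel)
qed

text \<open>
  Multiplying \<open>J A J = B\<close> by \<open>J\<^sup>-\<^sup>1\<close> on both sides gives the equation that characterizes \<open>J(B,A)\<close>.
\<close>

lemma bw_J_swap:
  assumes "A \<in> pd_mats" "B \<in> pd_mats"
  shows "matrix_inv (bw_J A B) = bw_J B A"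
proof (rule bw_J_unique)
  let ?J = "bw_J A B"
  note J = bw_J_pd[OF assms]
  have "matrix_inv ?J ** (?J ** A ** ?J) ** matrix_inv ?J = A"
    by (simp add: matrix_mul_assoc[symmetric] pd_inv_right[OF J] pd_inv_left[OF J, THEN matrix_cancel])
  then show "matrix_inv ?J ** B ** matrix_inv ?J = A"
    by (simp add: bw_J_equation assms)
qed (intro assms pd_matrix_inv bw_J_pd)+

lemma continuous_on_bw_J:
  "continuous_on (pd_mats \<times> pd_mats) (\<lambda>(X, Y). bw_J X Y)"
proof -
  have sqrt: "continuous_on S (\<lambda>z. mat_sqrt (f z))"
    if "continuous_on S f" "\<And>z. z \<in> S \<Longrightarrow> f z \<in> pd_mats"
    for S and f :: "'x::topological_space \<Rightarrow> real^'n^'n"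
    using continuous_on_compose2[OF continuous_on_mat_sqrt that(1)] that(2) by blast
  have inv: "continuous_on S (\<lambda>z. matrix_inv (f z))"
    if "continuous_on S f" "\<And>z. z \<in> S \<Longrightarrow> f z \<in> pd_mats"
    for S and f :: "'x::topological_space \<Rightarrow> real^'n^'n"
    using continuous_on_compose2[OF continuous_on_matrix_inv that(1)] that(2) pd_invertible by blast
  show ?thesis
    unfolding bw_J_def mat_inv_sqrt_def split_beta
    by (intro bounded_bilinear.continuous_on[OF bounded_bilinear_matrix_mult] sqrt inv
        continuous_on_fst continuous_on_snd continuous_on_id)
      (auto intro: mat_sqrt_pd pd_sqrt_congruence)
qed

section \<open>The variational formula\<close>

text \<open>
  The difference of the two sides is the trace of \<open>W\<^sup>T S\<^sup>-\<^sup>1 W\<close> with \<open>W = (S - J) A\<^sup>1\<^sup>/\<^sup>2\<close>.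
\<close>

lemma trace_variational:
  assumes S: "S \<in> pd_mats" and A: "A \<in> pd_mats" and J: "J \<in> sym_mats"
  shows "2 * trace (J ** A) \<le> trace (S ** A) + trace (matrix_inv S ** (J ** A ** J))"
proof -
  define P where "P = mat_sqrt A"
  have P: "P \<in> pd_mats" "P ** P = A"
    using mat_sqrt_pd[OF A] mat_sqrt_square[OF A] by (simp_all add: P_def)
  let ?I = "matrix_inv S" and ?W = "(S - J) ** P"
  have "0 \<le> ?W \<bullet> (?I ** ?W)"
    using inner_mult_left_ge[of ?I 0 ?W] pd_psd[OF pd_matrix_inv[OF S]] by (simp add: psd_mats_def)
  also have "\<dots> = trace (P ** ((S - J) ** (?I ** ?W)))"
    using J pd_transpose[OF S] pd_transpose[OF P(1)]
    by (simp add: trace_transpose_mult[symmetric] matrix_transpose_mul transpose_diff sym_mats_def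
        matrix_mul_assoc)
  also have "\<dots> = trace ((S - J) ** (?I ** ?W) ** P)"
    by (rule trace_mul_sym)
  also have "(S - J) ** (?I ** ?W) ** P = (S - J) ** (?I ** ((S - J) ** A))"
    by (simp add: P(2)[symmetric] matrix_mul_assoc)
  also have "\<dots> = S ** A - J ** A - J ** A + J ** (?I ** (J ** A))"
    using pd_inv_right[OF S, THEN matrix_cancel] pd_inv_left[OF S, THEN matrix_cancel]
    by (simp add: matrix_mult_distribs)
  also have "trace \<dots> = trace (S ** A) - 2 * trace (J ** A) + trace (J ** (?I ** (J ** A)))"
    by (simp only: trace_add trace_sub)
  also have "trace (J ** (?I ** (J ** A))) = trace (?I ** (J ** A) ** J)"
    by (rule trace_mul_sym)
  finally show ?thesis by (simp add: matrix_mul_assoc)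
qed

lemma bw_phi_le:
  assumes "S \<in> pd_mats" "A \<in> pd_mats" "B \<in> pd_mats"
  shows "bw_phi A B \<le> S \<bullet> A + matrix_inv S \<bullet> B"
  using trace_variational[OF assms(1,2) pd_sym[OF bw_J_pd[OF assms(2,3)]]] assms
  by (simp add: bw_phi_eq_trace bw_J_equation trace_sym_mult pd_sym pd_matrix_inv)

lemma bw_phi_eq:
  assumes "A \<in> pd_mats" "B \<in> pd_mats"
  shows "bw_phi A B = bw_J A B \<bullet> A + bw_J B A \<bullet> B"
proof -
  let ?J = "bw_J A B"
  note J = bw_J_pd[OF assms]
  have "bw_J B A \<bullet> B = trace (matrix_inv ?J ** (?J ** A ** ?J))"
    using assms by (simp add: bw_J_swap bw_J_equation trace_sym_mult pd_sym bw_J_pd)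
  also have "\<dots> = trace (A ** ?J)"
    by (simp add: matrix_mul_assoc[symmetric] pd_inv_left[OF J, THEN matrix_cancel])
  also have "\<dots> = ?J \<bullet> A"
    by (simp add: trace_mul_sym[of A] trace_sym_mult pd_sym J)
  finally show ?thesis
    by (simp add: bw_phi_eq_trace[OF assms] trace_sym_mult pd_sym J)
qed

section \<open>Supergradients and directional limits\<close>

text \<open>
  Using the supergradient at \<open>x\<close> and the one at \<open>y\<close> confines the remainder
  \<open>f y - f x - g x \<bullet> (y - x)\<close> to the interval from \<open>(g y - g x) \<bullet> (y - x)\<close> to \<open>0\<close>, and the lower end
  is \<open>o(|y - x|)\<close> by continuity of \<open>g\<close>.
\<close>

lemma has_derivative_supergradient:
  fixes f :: "'a::real_inner \<Rightarrow> real"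
  assumes super: "\<And>y z. y \<in> S \<Longrightarrow> z \<in> S \<Longrightarrow> f z \<le> f y + g y \<bullet> (z - y)"
    and x: "x \<in> S" and cont: "continuous (at x within S) g"
  shows "(f has_derivative (\<lambda>h. g x \<bullet> h)) (at x within S)"
proof (rule has_derivativeI_sandwich[of 1])
  show "((\<lambda>y. norm (g y - g x)) \<longlongrightarrow> 0) (at x within S)"
    using cont unfolding continuous_within
    by (simp add: tendsto_norm_zero_iff Lim_null[of g])
  fix y assume y: "y \<in> S" "y \<noteq> x"
  have "f y - f x - g x \<bullet> (y - x) \<le> 0" using super[OF x y(1)] by simp
  moreover have "(g y - g x) \<bullet> (y - x) \<le> f y - f x - g x \<bullet> (y - x)"
    using super[OF y(1) x] by (simp add: inner_diff)
  ultimately have "norm (f y - f x - g x \<bullet> (y - x)) \<le> \<bar>(g y - g x) \<bullet> (y - x)\<bar>"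
    by simp
  also have "\<dots> \<le> norm (g y - g x) * norm (y - x)"
    by (rule Cauchy_Schwarz_ineq2)
  finally show "norm (f y - f x - g x \<bullet> (y - x)) / norm (y - x) \<le> norm (g y - g x)"
    using y(2) by (simp add: pos_divide_le_eq)
qed (auto intro: bounded_linear_inner_right)

text \<open>
  The curve \<open>t \<mapsto> x + t u(t)\<close> passes through \<open>x\<close> at \<open>t = 0\<close> whatever \<open>u(0)\<close> is, and it has right
  derivative \<open>v\<close> there as soon as \<open>u(t)\<close> tends to \<open>v\<close>. The chain rule applies on an interval \<open>(0,d)\<close>
  that the curve maps into \<open>S\<close>.
\<close>

lemma has_derivative_right_quotient:
  fixes f :: "'a::real_normed_vector \<Rightarrow> real"
  assumes f: "(f has_derivative f') (at x within S)"
    and u: "(u \<longlongrightarrow> v) (at_right 0)"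
    and S: "\<forall>\<^sub>F t in at_right 0. x + t *\<^sub>R u t \<in> S"
  shows "((\<lambda>t. (f (x + t *\<^sub>R u t) - f x) / t) \<longlongrightarrow> f' v) (at_right 0)"
proof -
  obtain d :: real where d: "d > 0" "\<And>t. 0 < t \<Longrightarrow> t < d \<Longrightarrow> x + t *\<^sub>R u t \<in> S"
    using S unfolding eventually_at_right_field by auto
  let ?c = "\<lambda>t. x + t *\<^sub>R u t" and ?I = "{0<..<d}"
  have I: "at 0 within ?I = at_right 0"
    by (rule at_within_nhd[of _ "{..<d}"]) (use d in auto)
  have "(?c has_derivative (\<lambda>s. s *\<^sub>R v)) (at 0 within ?I)"
  proof (rule has_derivativeI_sandwich[of 1])
    show "((\<lambda>t. norm (u t - v)) \<longlongrightarrow> 0) (at 0 within ?I)"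
      unfolding I using u by (simp add: tendsto_norm_zero_iff Lim_null[of u])
    show "norm (?c t - ?c 0 - (t - 0) *\<^sub>R v) / norm (t - 0) \<le> norm (u t - v)"
      if "t \<noteq> 0" for t :: real
      using that by (simp flip: scaleR_diff_right)
  qed (auto intro: bounded_linear_scaleR_left)
  moreover have "(f has_derivative f') (at (?c 0) within ?c ` ?I)"
    using d(2) by (auto intro!: has_derivative_subset[OF f])
  ultimately have "((\<lambda>t. f (?c t)) has_derivative (\<lambda>s. f' (s *\<^sub>R v))) (at 0 within ?I)"
    by (rule has_derivative_in_compose)
  moreover have "f' (s *\<^sub>R v) = f' v * s" for s
    using linear_scale[OF has_derivative_linear[OF f]] by (simp add: mult.commute)
  ultimately have "((\<lambda>t. f (?c t)) has_field_derivative f' v) (at 0 within ?I)"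
    by (simp add: has_field_derivative_def mult_commute_abs)
  then show ?thesis
    unfolding has_field_derivative_iff I by simp
qed

section \<open>The derivative of the Bures--Wasserstein distance\<close>

lemma eventually_pd_perturbation:
  assumes A: "A \<in> pd_mats" and sym: "\<And>t. t > 0 \<Longrightarrow> Gt t \<in> sym_mats"
    and lim: "(Gt \<longlongrightarrow> G) (at_right 0)"
  shows "\<forall>\<^sub>F t in at_right (0::real). A + t *\<^sub>R Gt t \<in> pd_mats"
proof -
  obtain e where e: "e > 0" "\<And>T. T \<in> sym_mats \<Longrightarrow> norm (T - A) < e \<Longrightarrow> T \<in> pd_mats"
    by (rule pd_near[OF A]) blast
  have "((\<lambda>t. t *\<^sub>R Gt t) \<longlongrightarrow> 0 *\<^sub>R G) (at_right 0)"
    by (intro tendsto_intros lim)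
  then have "\<forall>\<^sub>F t in at_right 0. norm (t *\<^sub>R Gt t) < e"
    using e(1) by (simp add: tendsto_iff dist_norm)
  then show ?thesis
    using eventually_at_right_less[of 0]
  proof eventually_elim
    case (elim t)
    have "A + t *\<^sub>R Gt t \<in> sym_mats"
      using sym[OF elim(2)] pd_transpose[OF A] by (simp add: sym_mats_def transpose_add transpose_scalar)
    with elim(1) show ?case by (intro e(2)) simp_all
  qed
qed

text \<open>
  The supergradient at \<open>(X,Y)\<close> is \<open>(J(X,Y), J(X,Y)\<^sup>-\<^sup>1)\<close>. Writing its second component as \<open>J(Y,X)\<close>
  reduces its continuity to that of \<open>J\<close>.
\<close>

lemma bw_phi_has_derivative:
  fixes A B :: "real^'n^'n"
  assumes A: "A \<in> pd_mats" and B: "B \<in> pd_mats"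
  shows "((\<lambda>(X, Y). bw_phi X Y) has_derivative
     (\<lambda>(U, V). trace (bw_J A B ** U) + trace (matrix_inv (bw_J A B) ** V)))
     (at (A, B) within pd_mats \<times> pd_mats)"
proof -
  let ?g = "\<lambda>(X, Y). (bw_J X Y, bw_J Y X)"
  have "((\<lambda>(X, Y). bw_phi X Y) has_derivative (\<lambda>h. ?g (A, B) \<bullet> h))
    (at (A, B) within pd_mats \<times> pd_mats)"
  proof (rule has_derivative_supergradient)
    show "(A, B) \<in> pd_mats \<times> pd_mats" using A B by simp
    have "continuous_on (pd_mats \<times> pd_mats) (\<lambda>(X, Y). bw_J Y X :: real^'n^'n)"
      using continuous_on_compose2[OF continuous_on_bw_J continuous_on_swap[of "pd_mats \<times> pd_mats"]]
      by (simp add: split_beta product_swap)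
    then have "continuous_on (pd_mats \<times> pd_mats) (?g :: _ \<Rightarrow> (real^'n^'n) \<times> (real^'n^'n))"
      using continuous_on_bw_J unfolding split_beta by (intro continuous_on_Pair)
    then show "continuous (at (A, B) within pd_mats \<times> pd_mats) ?g"
      using A B by (simp add: continuous_on_eq_continuous_within)
    fix y z :: "(real^'n^'n) \<times> (real^'n^'n)"
    assume "y \<in> pd_mats \<times> pd_mats" "z \<in> pd_mats \<times> pd_mats"
    then obtain X Y X' Y' where y: "y = (X, Y)" "X \<in> pd_mats" "Y \<in> pd_mats"
      and z: "z = (X', Y')" "X' \<in> pd_mats" "Y' \<in> pd_mats" by auto
    show "(case z of (X, Y) \<Rightarrow> bw_phi X Y) \<le> (case y of (X, Y) \<Rightarrow> bw_phi X Y) + ?g y \<bullet> (z - y)"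
      using bw_phi_le[OF bw_J_pd[OF y(2,3)] z(2,3)] bw_phi_eq[OF y(2,3)]
      by (simp add: y z bw_J_swap inner_diff_right)
  qed
  moreover have "?g (A, B) \<bullet> h = (case h of (U, V) \<Rightarrow>
      trace (bw_J A B ** U) + trace (matrix_inv (bw_J A B) ** V))" for h
    using A B by (auto simp: bw_J_swap trace_sym_mult pd_sym bw_J_pd split: prod.split)
  ultimately show ?thesis by simp
qed

lemma bw_dist_sq_has_derivative:
  fixes A B :: "real^'n^'n"
  assumes "A \<in> pd_mats" "B \<in> pd_mats"
  shows "((\<lambda>(X, Y). bw_dist_sq X Y) has_derivative
     (\<lambda>(U, V). trace ((mat 1 - bw_J A B) ** U) + trace ((mat 1 - matrix_inv (bw_J A B)) ** V)))
     (at (A, B) within pd_mats \<times> pd_mats)"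
proof -
  have trace_eq: "(trace :: real^'n^'n \<Rightarrow> real) = (\<bullet>) (mat 1)"
    using trace_transpose_mult[of "mat 1 :: real^'n^'n"] by (auto simp: fun_eq_iff)
  have "bounded_linear (trace :: real^'n^'n \<Rightarrow> real)"
    unfolding trace_eq by (rule bounded_linear_inner_right)
  note tr = bounded_linear.has_derivative[OF this]
  have "((\<lambda>z. trace (fst z) + trace (snd z) - (case z of (X, Y) \<Rightarrow> bw_phi X Y)) has_derivative
     (\<lambda>h. trace (fst h) + trace (snd h) - (case h of (U, V) \<Rightarrow>
        trace (bw_J A B ** U) + trace (matrix_inv (bw_J A B) ** V))))
     (at (A, B) within pd_mats \<times> pd_mats)"
    by (intro has_derivative_diff has_derivative_add tr has_derivative_fst has_derivative_snd
        has_derivative_ident bw_phi_has_derivative assms)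
  moreover have "(\<lambda>z. trace (fst z) + trace (snd z) - (case z of (X, Y) \<Rightarrow> bw_phi X Y))
      = (\<lambda>(X, Y). bw_dist_sq X (Y :: real^'n^'n))"
    by (auto simp: fun_eq_iff bw_dist_sq_def bw_phi_def)
  moreover have "(\<lambda>h. trace (fst h) + trace (snd h) - (case h of (U, V) \<Rightarrow>
        trace (bw_J A B ** U) + trace (matrix_inv (bw_J A B) ** V)))
      = (\<lambda>(U, V). trace ((mat 1 - bw_J A B) ** U) + trace ((mat 1 - matrix_inv (bw_J A B)) ** V))"
    by (auto simp: fun_eq_iff matrix_mult_distribs trace_sub)
  ultimately show ?thesis by simp
qed

theorem lemma4p13:
  fixes A B G H :: "real^'n^'n"
    and Gt Ht :: "real \<Rightarrow> real^'n^'n"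
  assumes "A \<in> pd_mats" and "B \<in> pd_mats"
    and "G \<in> sym_mats" and "H \<in> sym_mats"
    and "\<And>t. t > 0 \<Longrightarrow> Gt t \<in> sym_mats"
    and "\<And>t. t > 0 \<Longrightarrow> Ht t \<in> sym_mats"
    and "\<And>i j. ((\<lambda>t. Gt t $ i $ j) \<longlongrightarrow> G $ i $ j) (at_right 0)"
    and "\<And>i j. ((\<lambda>t. Ht t $ i $ j) \<longlongrightarrow> H $ i $ j) (at_right 0)"
  shows
    "bw_J A B =
       mat_sqrt B ** mat_inv_sqrt (mat_sqrt B ** A ** mat_sqrt B) ** mat_sqrt B
     \<and> invertible (bw_J A B)
     \<and> matrix_inv (bw_J A B) =
       mat_sqrt A ** mat_inv_sqrt (mat_sqrt A ** B ** mat_sqrt A) ** mat_sqrt A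
     \<and> matrix_inv (bw_J A B) =
       mat_inv_sqrt B ** mat_sqrt (mat_sqrt B ** A ** mat_sqrt B) ** mat_inv_sqrt B
     \<and> ((\<lambda>t. (bw_phi (A + t *\<^sub>R Gt t) (B + t *\<^sub>R Ht t) - bw_phi A B) / t)
         \<longlongrightarrow> trace (bw_J A B ** G) + trace (matrix_inv (bw_J A B) ** H)) (at_right 0)
     \<and> ((\<lambda>(X, Y). bw_phi X Y) has_derivative
          (\<lambda>(U, V). trace (bw_J A B ** U) + trace (matrix_inv (bw_J A B) ** V)))
         (at (A, B) within pd_mats \<times> pd_mats)
     \<and> ((\<lambda>t. (bw_dist_sq (A + t *\<^sub>R Gt t) (B + t *\<^sub>R Ht t) - bw_dist_sq A B) / t)
         \<longlongrightarrow> trace ((mat 1 - bw_J A B) ** G)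
             + trace ((mat 1 - matrix_inv (bw_J A B)) ** H)) (at_right 0)
     \<and> ((\<lambda>(X, Y). bw_dist_sq X Y) has_derivative
          (\<lambda>(U, V). trace ((mat 1 - bw_J A B) ** U)
             + trace ((mat 1 - matrix_inv (bw_J A B)) ** V)))
         (at (A, B) within pd_mats \<times> pd_mats)"
proof -
  note AB = assms(1,2)
  have Gt: "(Gt \<longlongrightarrow> G) (at_right 0)" and Ht: "(Ht \<longlongrightarrow> H) (at_right 0)"
    using assms(7,8) by (auto intro!: vec_tendstoI)
  have u: "((\<lambda>t. (Gt t, Ht t)) \<longlongrightarrow> (G, H)) (at_right 0)"
    by (intro tendsto_Pair Gt Ht)
  have S: "\<forall>\<^sub>F t in at_right 0. (A, B) + t *\<^sub>R (Gt t, Ht t) \<in> pd_mats \<times> pd_mats"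
  proof -
    have "\<forall>\<^sub>F t in at_right 0. A + t *\<^sub>R Gt t \<in> pd_mats"
      by (intro eventually_pd_perturbation[of _ _ G] AB assms(5) Gt)
    moreover have "\<forall>\<^sub>F t in at_right 0. B + t *\<^sub>R Ht t \<in> pd_mats"
      by (intro eventually_pd_perturbation[of _ _ H] AB assms(6) Ht)
    ultimately show ?thesis by eventually_elim simp
  qed
  have "bw_J A B = matrix_inv (bw_J B A)"
    by (simp add: bw_J_swap AB)
  moreover have "matrix_inv (bw_J A B) =
       mat_inv_sqrt B ** mat_sqrt (mat_sqrt B ** A ** mat_sqrt B) ** mat_inv_sqrt B"
    by (simp add: bw_J_swap AB bw_J_def[of B A])
  ultimately show ?thesis
    using matrix_inv_bw_J[OF AB(2,1)] matrix_inv_bw_J[OF AB] pd_invertible[OF bw_J_pd[OF AB]]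
      bw_phi_has_derivative[OF AB] bw_dist_sq_has_derivative[OF AB]
      has_derivative_right_quotient[OF bw_phi_has_derivative[OF AB] u S]
      has_derivative_right_quotient[OF bw_dist_sq_has_derivative[OF AB] u S]
    by simp
qed

end
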